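(* Let $K\ge 2$, let $\mu_1>\mu_2>\cdots>\mu_K$ be real numbers, let $\sigma_1,\dots,\sigma_K>0$, and suppose that for each $i\in\{1,\dots,K\}$ the samples $X_{i1},X_{i2},\dots$ are i.i.d. $\mathcal{N}(\mu_i,\sigma_i^2)$, with samples independent across different designs $i$. Let $\alpha_0\in(0,1)$ and let the initial sample size be $N_0=\lfloor\alpha_0T\rfloor$, where $T$ is the total budget. Then, for each of the algorithms OCBA, OCBA-D and OCBA-R, there exist positive constants $C_1,\dots,C_K$ (independent of $T$) such that $$\mathrm{PFS}(T)\ \le\ C_1\exp\left(-\frac{\delta^2\alpha_0T}{8\sigma_1^2K}\right)+\sum_{i=2}^K C_i\exp\left(-\frac{\bar\delta_i^2\alpha_0T}{2\sigma_i^2K}\right)$$ for all $T\ge KN_0$ (with $N_0\ge2$, as the algorithms require), where $\delta=\mu_1-\mu_2$ and $\bar\delta_i=\mu_2-\mu_i+\frac{\delta}{2}$ for $i=2,\dots,K$.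
   Context: Setting. The set of designs is $\mathcal{I}=\{1,\dots,K\}$ and $X_{ir}$ is the output of the $r$th simulation run of design $i$. The true best design is $b=\arg\max_{i}\mu_i$. For $n\ge 2$, $\bar X_{i,n}=\frac1n\sum_{r=1}^n X_{ir}$ and $S_{i,n}^2=\frac1{n-1}\sum_{r=1}^n (X_{ir}-\bar X_{i,n})^2$, $S_{i,n}\ge 0$. $N_i(\ell)$ denotes the number of runs of design $i$ available at the beginning of iteration $\ell=0,1,2,\dots$; $\bar X_i(\ell)=\bar X_{i,N_i(\ell)}$, $S_i(\ell)=S_{i,N_i(\ell)}$. Ties (which have probability zero where relevant) are broken by any fixed rule. $\lfloor\cdot\rfloor$ is the floor function. Estimated fractions. With $\hat b=\hat b(\ell)=\arg\max_{i}\bar X_i(\ell)$, let $$\hat\beta_i(\ell)=\frac{S_i^2(\ell)}{[\bar X_{\hat b}(\ell)-\bar X_i(\ell)]^2}\ (i\ne\hat b),\qquad \hat\beta_{\hat b}(\ell)=S_{\hat b}(\ell)\sqrt{\sum_{i\neq\hat b}\hat\beta_i^2(\ell)/S_i^2(\ell)},\qquad \hat\alpha_i(\ell)=\frac{\hat\beta_i(\ell)}{\sum_{j\in\mathcal I}\hat\beta_j(\ell)} .$$ All three algorithms take as input $N_0\ge2$ and a total budget $T\ge KN_0$, and start by running $N_0$ replications of each design, so $N_i(0)=N_0$. When they stop, they output $\hat b=\arg\max_i \bar X_i(\ell)$ for the final $\ell$. OCBA (with additional fixed input $\Delta\ge1$): let $T'(\ell)=KN_0+(\ell+1)\Delta$.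 While $\sum_i N_i(\ell)<T$ and $T'(\ell)\le T$: compute $\hat\alpha_i(\ell)$; for each $i$ run $\max\{0,\lfloor\hat\alpha_i(\ell)T'(\ell)\rfloor-N_i(\ell)\}$ further replications of design $i$, so $N_i(\ell+1)=\max\{N_i(\ell),\lfloor\hat\alpha_i(\ell)T'(\ell)\rfloor\}$; then increase $\ell$ by one. OCBA-D: while $\sum_i N_i(\ell)<T$: compute $\hat\alpha_i(\ell)$; run one replication of design $i^*=\arg\max_i\{\hat\alpha_i(\ell)/N_i(\ell)\}$; set $N_{i^*}(\ell+1)=N_{i^*}(\ell)+1$ and $N_i(\ell+1)=N_i(\ell)$ for $i\ne i^*$; increase $\ell$ by one. OCBA-R: as OCBA-D, except that $i^*=\min\{k\in\{1,\dots,K\}: U(\ell)\le\sum_{i=1}^k\hat\alpha_i(\ell)\}$, where $U(0),U(1),\dots$ are i.i.d. Uniform$(0,1)$ and independent of all samples. $\mathrm{PFS}(T)$, the probability of false selection, is the probability that the output $\hat b$ of the algorithm run with budget $T$ differs from $b$. *)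

theory Defs
  imports "HOL-Probability.Probability"
begin

text \<open>
  Designs are the numbers \<open>1, \<dots>, K\<close>. A sample path of the simulation outputs is a function
  \<open>x :: nat \<Rightarrow> nat \<Rightarrow> real\<close>, where \<open>x i r\<close> is the output of run \<open>r \<ge> 1\<close> of design \<open>i\<close>; an
  allocation \<open>N :: nat \<Rightarrow> nat\<close> gives the number of runs of each design so far.
  The algorithms are defined pathwise and become random by inserting \<open>x = (\<lambda>i r. X i r \<omega>)\<close>.
\<close>

definition sample_mean :: "(nat \<Rightarrow> real) \<Rightarrow> nat \<Rightarrow> real" where
  "sample_mean y n = (\<Sum>r=1..n. y r) / real n"

definition sample_var :: "(nat \<Rightarrow> real) \<Rightarrow> nat \<Rightarrow> real" where
  "sample_var y n = (\<Sum>r=1..n. (y r - sample_mean y n)\<^sup>2) / (real n - 1)"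

definition sample_sd :: "(nat \<Rightarrow> real) \<Rightarrow> nat \<Rightarrow> real" where
  "sample_sd y n = sqrt (sample_var y n)"

definition tie_rule :: "nat \<Rightarrow> (nat set \<Rightarrow> nat) \<Rightarrow> bool" where
  "tie_rule K tie \<longleftrightarrow> (\<forall>A. A \<noteq> {} \<and> A \<subseteq> {1..K} \<longrightarrow> tie A \<in> A)"

definition argmax_design :: "(nat set \<Rightarrow> nat) \<Rightarrow> nat \<Rightarrow> (nat \<Rightarrow> real) \<Rightarrow> nat" where
  "argmax_design tie K f = tie {i. is_arg_max f (\<lambda>j. j \<in> {1..K}) i}"

definition best_hat ::
  "(nat set \<Rightarrow> nat) \<Rightarrow> nat \<Rightarrow> (nat \<Rightarrow> nat \<Rightarrow> real) \<Rightarrow> (nat \<Rightarrow> nat) \<Rightarrow> nat" where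
  "best_hat tie K x N = argmax_design tie K (\<lambda>i. sample_mean (x i) (N i))"

text \<open>
  On the null event that sample means coincide or a sample variance vanishes, the fractions below
  take the values given by the convention \<open>a / 0 = 0\<close>.
\<close>

definition beta_nonbest :: "(nat \<Rightarrow> nat \<Rightarrow> real) \<Rightarrow> (nat \<Rightarrow> nat) \<Rightarrow> nat \<Rightarrow> nat \<Rightarrow> real" where
  "beta_nonbest x N b i =
     (sample_sd (x i) (N i))\<^sup>2 / (sample_mean (x b) (N b) - sample_mean (x i) (N i))\<^sup>2"

definition beta_hat ::
  "(nat set \<Rightarrow> nat) \<Rightarrow> nat \<Rightarrow> (nat \<Rightarrow> nat \<Rightarrow> real) \<Rightarrow> (nat \<Rightarrow> nat) \<Rightarrow> nat \<Rightarrow> real" where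
  "beta_hat tie K x N i =
     (let b = best_hat tie K x N in
      if i = b
      then sample_sd (x b) (N b) *
             sqrt (\<Sum>j\<in>{1..K} - {b}. (beta_nonbest x N b j)\<^sup>2 / (sample_sd (x j) (N j))\<^sup>2)
      else beta_nonbest x N b i)"

definition alpha_hat ::
  "(nat set \<Rightarrow> nat) \<Rightarrow> nat \<Rightarrow> (nat \<Rightarrow> nat \<Rightarrow> real) \<Rightarrow> (nat \<Rightarrow> nat) \<Rightarrow> nat \<Rightarrow> real" where
  "alpha_hat tie K x N i = beta_hat tie K x N i / (\<Sum>j=1..K. beta_hat tie K x N j)"

text \<open>
  The loop of each algorithm is unrolled: the allocation after \<open>l\<close> iterations is defined for
  every \<open>l\<close>, and the output is read off at the first \<open>l\<close> at which the loop condition fails.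
\<close>

definition ocba_budget :: "nat \<Rightarrow> real \<Rightarrow> nat \<Rightarrow> nat \<Rightarrow> real" where
  "ocba_budget K \<Delta> N0 l = real (K * N0) + (real l + 1) * \<Delta>"

primrec ocba_alloc ::
  "(nat set \<Rightarrow> nat) \<Rightarrow> nat \<Rightarrow> real \<Rightarrow> nat \<Rightarrow> (nat \<Rightarrow> nat \<Rightarrow> real) \<Rightarrow> nat \<Rightarrow> nat \<Rightarrow> nat" where
  "ocba_alloc tie K \<Delta> N0 x 0 = (\<lambda>i. N0)"
| "ocba_alloc tie K \<Delta> N0 x (Suc l) =
     (let N = ocba_alloc tie K \<Delta> N0 x l in
      (\<lambda>i. max (N i) (nat \<lfloor>alpha_hat tie K x N i * ocba_budget K \<Delta> N0 l\<rfloor>)))"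

definition ocba_output ::
  "(nat set \<Rightarrow> nat) \<Rightarrow> nat \<Rightarrow> real \<Rightarrow> nat \<Rightarrow> real \<Rightarrow> (nat \<Rightarrow> nat \<Rightarrow> real) \<Rightarrow> nat" where
  "ocba_output tie K \<Delta> N0 T x =
     (let N = ocba_alloc tie K \<Delta> N0 x;
          L = (LEAST l. \<not> (real (\<Sum>i=1..K. N l i) < T \<and> ocba_budget K \<Delta> N0 l \<le> T))
      in best_hat tie K x (N L))"

text \<open>
  The common scheme of OCBA-D and OCBA-R: in iteration \<open>l\<close> with current allocation \<open>N\<close>, one
  replication of design \<open>sel l N\<close> is run.
\<close>

primrec seq_alloc :: "(nat \<Rightarrow> (nat \<Rightarrow> nat) \<Rightarrow> nat) \<Rightarrow> nat \<Rightarrow> nat \<Rightarrow> nat \<Rightarrow> nat" where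
  "seq_alloc sel N0 0 = (\<lambda>i. N0)"
| "seq_alloc sel N0 (Suc l) =
     (let N = seq_alloc sel N0 l; i = sel l N in N(i := N i + 1))"

definition seq_output ::
  "(nat set \<Rightarrow> nat) \<Rightarrow> nat \<Rightarrow> (nat \<Rightarrow> (nat \<Rightarrow> nat) \<Rightarrow> nat) \<Rightarrow> nat \<Rightarrow> real
     \<Rightarrow> (nat \<Rightarrow> nat \<Rightarrow> real) \<Rightarrow> nat" where
  "seq_output tie K sel N0 T x =
     (let N = seq_alloc sel N0;
          L = (LEAST l. \<not> real (\<Sum>i=1..K. N l i) < T)
      in best_hat tie K x (N L))"

definition ocba_d_output ::
  "(nat set \<Rightarrow> nat) \<Rightarrow> nat \<Rightarrow> nat \<Rightarrow> real \<Rightarrow> (nat \<Rightarrow> nat \<Rightarrow> real) \<Rightarrow> nat" where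
  "ocba_d_output tie K N0 T x =
     seq_output tie K
       (\<lambda>l N. argmax_design tie K (\<lambda>i. alpha_hat tie K x N i / real (N i))) N0 T x"

text \<open>
  \<open>u l\<close> is the realisation of the uniform variable used in iteration \<open>l\<close>. Almost surely it is at
  most \<open>1 = (\<Sum>i=1..K. alpha_hat tie K x N i)\<close>, so that the minimum is over a nonempty set.
\<close>

definition ocba_r_output ::
  "(nat set \<Rightarrow> nat) \<Rightarrow> nat \<Rightarrow> nat \<Rightarrow> real \<Rightarrow> (nat \<Rightarrow> nat \<Rightarrow> real) \<Rightarrow> (nat \<Rightarrow> real) \<Rightarrow> nat" where
  "ocba_r_output tie K N0 T x u =
     seq_output tie K
       (\<lambda>l N. Min {k \<in> {1..K}. u l \<le> (\<Sum>i=1..k. alpha_hat tie K x N i)}) N0 T x"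

definition pfs ::
  "'a measure \<Rightarrow> (nat set \<Rightarrow> nat) \<Rightarrow> nat \<Rightarrow> (nat \<Rightarrow> real) \<Rightarrow> ('a \<Rightarrow> nat) \<Rightarrow> real" where
  "pfs M tie K \<mu> out = measure M {\<omega> \<in> space M. out \<omega> \<noteq> argmax_design tie K \<mu>}"

end

theory Submission imports Defs begin

text \<open>
  Whatever an allocation rule decides, every design keeps the
  \<open>N\<^sub>0 = \<lfloor>\<alpha>\<^sub>0 T\<rfloor>\<close> runs it received at the start. Put the threshold \<open>c = \<mu>\<^sub>1 - \<delta>/2\<close> halfway between
  the two best means. If the output is not design 1, then the final sample mean of design 1 is at
  most \<open>c\<close>, or that of some design \<open>i \<ge> 2\<close> is at least \<open>c\<close>. The number of runs behind this sample
  mean is random and depends on the samples, but it is at least \<open>N\<^sub>0\<close>; so the error event lies in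
  the union, over the designs \<open>i\<close> and over all \<^emph>\<open>deterministic\<close> sizes \<open>n \<ge> N\<^sub>0\<close>, of the events that
  the mean of the first \<open>n\<close> samples of design \<open>i\<close> is on the wrong side of \<open>c\<close>.

  For a deterministic \<open>n\<close> this mean is normal with variance \<open>\<sigma>\<^sub>i\<^sup>2/n\<close>, so it is on the wrong
  side with probability at most \<open>exp (- a\<^sub>i n)\<close> with \<open>a\<^sub>i = (c - \<mu>\<^sub>i)\<^sup>2/(2\<sigma>\<^sub>i\<^sup>2)\<close>
  (\<open>normal_sample_mean_upper_tail\<close>, \<open>normal_sample_mean_lower_tail\<close>). The geometric series over
  \<open>n \<ge> N\<^sub>0\<close> costs only the factor \<open>1/(1 - exp (- a\<^sub>i))\<close> (\<open>prob_exists_ge_le_exp\<close>), which gives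
  \<open>pfs_le_sum_exp\<close> for every allocation with at least \<open>N\<^sub>0\<close> runs of each design. Since
  \<open>c - \<mu>\<^sub>1 = -\<delta>/2\<close> and \<open>c - \<mu>\<^sub>i = \<delta>bar i\<close> for \<open>i \<ge> 2\<close>, the exponents of the claimed bound are
  \<open>a\<^sub>i \<alpha>\<^sub>0 T / K \<le> a\<^sub>i \<alpha>\<^sub>0 T\<close>. Rounding \<open>\<alpha>\<^sub>0 T\<close> down costs at most the factor \<open>exp a\<^sub>i\<close>, so that
  \<open>C\<^sub>i = exp a\<^sub>i / (1 - exp (- a\<^sub>i))\<close> serves for all three algorithms.
\<close>

section \<open>Gaussian tails of sample means\<close>

text \<open>
  On \<open>x \<ge> \<mu> + d\<close> the density of \<open>\<N>(\<mu>, \<sigma>\<^sup>2)\<close> is at most \<open>exp (- d\<^sup>2/(2\<sigma>\<^sup>2))\<close> times that of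
  \<open>\<N>(\<mu> + d, \<sigma>\<^sup>2)\<close>, because \<open>(x - \<mu>)\<^sup>2 \<ge> (x - \<mu> - d)\<^sup>2 + d\<^sup>2\<close> there; the shifted density integrates
  to one.
\<close>

lemma (in prob_space) normal_upper_tail:
  assumes Y: "distributed M lborel Y (normal_density \<mu> \<sigma>)" and "\<sigma> > 0" and "d \<ge> 0"
  shows "prob {\<omega> \<in> space M. \<mu> + d \<le> Y \<omega>} \<le> exp (- (d\<^sup>2 / (2 * \<sigma>\<^sup>2)))"
proof -
  have density_le: "normal_density \<mu> \<sigma> x * indicator {\<mu> + d..} x
      \<le> exp (- (d\<^sup>2 / (2 * \<sigma>\<^sup>2))) * normal_density (\<mu> + d) \<sigma> x" for x
  proof (cases "\<mu> + d \<le> x")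
    case True
    have "0 \<le> d * (x - (\<mu> + d))"
      using True \<open>d \<ge> 0\<close> by simp
    then have "d\<^sup>2 + (x - (\<mu> + d))\<^sup>2 \<le> (x - \<mu>)\<^sup>2"
      by (simp add: power2_eq_square algebra_simps)
    then have "(d\<^sup>2 + (x - (\<mu> + d))\<^sup>2) / (2 * \<sigma>\<^sup>2) \<le> (x - \<mu>)\<^sup>2 / (2 * \<sigma>\<^sup>2)"
      by (intro divide_right_mono) auto
    then have "exp (- (x - \<mu>)\<^sup>2 / (2 * \<sigma>\<^sup>2))
        \<le> exp (- (d\<^sup>2 / (2 * \<sigma>\<^sup>2))) * exp (- (x - (\<mu> + d))\<^sup>2 / (2 * \<sigma>\<^sup>2))"
      by (simp add: exp_add [symmetric] add_divide_distrib)
    then have "1 / sqrt (2 * pi * \<sigma>\<^sup>2) * exp (- (x - \<mu>)\<^sup>2 / (2 * \<sigma>\<^sup>2)) \<le> 1 / sqrt (2 * pi * \<sigma>\<^sup>2) *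
        (exp (- (d\<^sup>2 / (2 * \<sigma>\<^sup>2))) * exp (- (x - (\<mu> + d))\<^sup>2 / (2 * \<sigma>\<^sup>2)))"
      by (intro mult_left_mono) auto
    with True show ?thesis
      by (simp add: normal_density_def mult_ac)
  qed simp
  have "emeasure M {\<omega> \<in> space M. \<mu> + d \<le> Y \<omega>} = emeasure M (Y -` {\<mu> + d..} \<inter> space M)"
    by (intro arg_cong [where f = "emeasure M"]) auto
  also have "\<dots> = (\<integral>\<^sup>+x. ennreal (normal_density \<mu> \<sigma> x) * indicator {\<mu> + d..} x \<partial>lborel)"
    using Y by (rule distributed_emeasure) simp
  also have "\<dots> \<le> (\<integral>\<^sup>+x. ennreal (exp (- (d\<^sup>2 / (2 * \<sigma>\<^sup>2))) * normal_density (\<mu> + d) \<sigma> x) \<partial>lborel)"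
  proof (intro nn_integral_mono)
    fix x :: real
    have "ennreal (normal_density \<mu> \<sigma> x) * indicator {\<mu> + d..} x
        = ennreal (normal_density \<mu> \<sigma> x * indicator {\<mu> + d..} x)"
      by (simp add: indicator_def)
    also have "\<dots> \<le> ennreal (exp (- (d\<^sup>2 / (2 * \<sigma>\<^sup>2))) * normal_density (\<mu> + d) \<sigma> x)"
      using density_le by (rule ennreal_leI)
    finally show "ennreal (normal_density \<mu> \<sigma> x) * indicator {\<mu> + d..} x
        \<le> ennreal (exp (- (d\<^sup>2 / (2 * \<sigma>\<^sup>2))) * normal_density (\<mu> + d) \<sigma> x)" .
  qed
  also have "\<dots> = ennreal (exp (- (d\<^sup>2 / (2 * \<sigma>\<^sup>2))))"
    using \<open>\<sigma> > 0\<close> by (subst nn_integral_eq_integral) auto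
  finally show ?thesis
    by (simp add: emeasure_eq_measure)
qed

lemma (in prob_space) normal_lower_tail:
  assumes Y: "distributed M lborel Y (normal_density \<mu> \<sigma>)" and "\<sigma> > 0" and "d \<ge> 0"
  shows "prob {\<omega> \<in> space M. Y \<omega> \<le> \<mu> - d} \<le> exp (- (d\<^sup>2 / (2 * \<sigma>\<^sup>2)))"
proof -
  have "distributed M lborel (\<lambda>\<omega>. - Y \<omega>) (normal_density (- \<mu>) \<sigma>)"
    using normal_density_affine [OF Y \<open>\<sigma> > 0\<close>, of "-1" 0] by simp
  from normal_upper_tail [OF this \<open>\<sigma> > 0\<close> \<open>d \<ge> 0\<close>]
  have "prob {\<omega> \<in> space M. - \<mu> + d \<le> - Y \<omega>} \<le> exp (- (d\<^sup>2 / (2 * \<sigma>\<^sup>2)))" .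
  moreover have "{\<omega> \<in> space M. - \<mu> + d \<le> - Y \<omega>} = {\<omega> \<in> space M. Y \<omega> \<le> \<mu> - d}"
    by auto
  ultimately show ?thesis
    by simp
qed

lemma (in prob_space) normal_sample_mean_distributed:
  assumes indep: "indep_vars (\<lambda>_. borel) Y {1::nat..}"
    and normal: "\<And>r. r \<ge> 1 \<Longrightarrow> distributed M lborel (Y r) (normal_density \<mu> \<sigma>)"
    and "\<sigma> > 0" and "n \<ge> 1"
  shows "distributed M lborel (\<lambda>\<omega>. sample_mean (\<lambda>r. Y r \<omega>) n) (normal_density \<mu> (\<sigma> / sqrt n))"
proof -
  have "indep_vars (\<lambda>_. borel) Y {1..n}"
    using indep by (rule indep_vars_subset) auto
  then have "distributed M lborel (\<lambda>\<omega>. \<Sum>r=1..n. Y r \<omega>)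
      (normal_density (\<Sum>r=1..n. \<mu>) (sqrt (\<Sum>r=1..n. \<sigma>\<^sup>2)))"
    using assms by (intro sum_indep_normal) auto
  also have "sqrt (\<Sum>r=1..n. \<sigma>\<^sup>2) = sqrt n * \<sigma>"
    using \<open>\<sigma> > 0\<close> by (simp add: real_sqrt_mult)
  finally have "distributed M lborel (\<lambda>\<omega>. 0 + 1 / n * (\<Sum>r=1..n. Y r \<omega>))
      (normal_density (0 + 1 / n * (\<Sum>r=1..n. \<mu>)) (\<bar>1 / n\<bar> * (sqrt n * \<sigma>)))"
    by (rule normal_density_affine) (use assms in auto)
  moreover have "\<bar>1 / n\<bar> * (sqrt n * \<sigma>) = \<sigma> / sqrt n"
    using \<open>n \<ge> 1\<close> by (simp add: field_simps)
  ultimately show ?thesis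
    using \<open>n \<ge> 1\<close> by (simp add: sample_mean_def)
qed

lemma (in prob_space) normal_sample_mean_upper_tail:
  assumes "indep_vars (\<lambda>_. borel) Y {1::nat..}"
    and "\<And>r. r \<ge> 1 \<Longrightarrow> distributed M lborel (Y r) (normal_density \<mu> \<sigma>)"
    and "\<sigma> > 0" and "n \<ge> 1" and "\<mu> \<le> c"
  shows "prob {\<omega> \<in> space M. c \<le> sample_mean (\<lambda>r. Y r \<omega>) n} \<le> exp (- ((c - \<mu>)\<^sup>2 / (2 * \<sigma>\<^sup>2) * n))"
  using normal_upper_tail [OF normal_sample_mean_distributed [OF assms(1-4)], of "c - \<mu>"] assms(3-)
  by (simp add: power_divide)

lemma (in prob_space) normal_sample_mean_lower_tail:
  assumes "indep_vars (\<lambda>_. borel) Y {1::nat..}"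
    and "\<And>r. r \<ge> 1 \<Longrightarrow> distributed M lborel (Y r) (normal_density \<mu> \<sigma>)"
    and "\<sigma> > 0" and "n \<ge> 1" and "c \<le> \<mu>"
  shows "prob {\<omega> \<in> space M. sample_mean (\<lambda>r. Y r \<omega>) n \<le> c} \<le> exp (- ((c - \<mu>)\<^sup>2 / (2 * \<sigma>\<^sup>2) * n))"
proof -
  have "(\<mu> - c)\<^sup>2 = (c - \<mu>)\<^sup>2"
    by (rule power2_commute)
  then show ?thesis
    using normal_lower_tail [OF normal_sample_mean_distributed [OF assms(1-4)], of "\<mu> - c"] assms(3-)
    by (simp add: power_divide)
qed

section \<open>False selection with data-dependent sample sizes\<close>

text \<open>
  A union bound over all sizes \<open>n \<ge> m\<close> at once: this is what makes a sample size chosen by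
  looking at the samples harmless. The exponential rate survives because the geometric series is
  dominated by its first term.
\<close>

lemma (in prob_space) prob_exists_ge_le_exp:
  assumes events: "\<And>n. n \<ge> m \<Longrightarrow> {\<omega> \<in> space M. P n \<omega>} \<in> events"
    and tail: "\<And>n. n \<ge> m \<Longrightarrow> prob {\<omega> \<in> space M. P n \<omega>} \<le> exp (- (a * real n))"
    and "a > 0"
  shows "{\<omega> \<in> space M. \<exists>n\<ge>m. P n \<omega>} \<in> events"
    and "prob {\<omega> \<in> space M. \<exists>n\<ge>m. P n \<omega>} \<le> exp (- (a * real m)) / (1 - exp (- a))"
proof -
  let ?A = "\<lambda>k. {\<omega> \<in> space M. P (m + k) \<omega>}"
  have Union: "{\<omega> \<in> space M. \<exists>n\<ge>m. P n \<omega>} = (\<Union>k. ?A k)"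
    by (auto simp: le_iff_add)
  have A: "range ?A \<subseteq> events"
    using events by auto
  then show "{\<omega> \<in> space M. \<exists>n\<ge>m. P n \<omega>} \<in> events"
    unfolding Union by blast
  have A_le: "prob (?A k) \<le> exp (- (a * real m)) * exp (- a) ^ k" for k
    using tail [of "m + k"] by (simp add: exp_of_nat_mult [symmetric] exp_add [symmetric] algebra_simps)
  have geometric: "(\<lambda>k. exp (- (a * real m)) * exp (- a) ^ k) sums
      (exp (- (a * real m)) * (1 / (1 - exp (- a))))"
    using \<open>a > 0\<close> by (intro sums_mult geometric_sums) simp
  then have summable: "summable (\<lambda>k. prob (?A k))"
    using A_le by (intro summable_comparison_test' [OF sums_summable]) auto
  then have "prob (\<Union>k. ?A k) \<le> (\<Sum>k. prob (?A k))"
    using A by (intro finite_measure_subadditive_countably)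
  also have "\<dots> \<le> (\<Sum>k. exp (- (a * real m)) * exp (- a) ^ k)"
    using A_le summable sums_summable [OF geometric] by (rule suminf_le)
  also have "\<dots> = exp (- (a * real m)) / (1 - exp (- a))"
    using sums_unique [OF geometric] by simp
  finally show "prob {\<omega> \<in> space M. \<exists>n\<ge>m. P n \<omega>} \<le> exp (- (a * real m)) / (1 - exp (- a))"
    unfolding Union .
qed

text \<open>
  With \<open>f = Pair i\<close> this extracts the samples of one design from a doubly indexed independent
  family. A choice of events for the \<open>X (f i)\<close> is transported along the inverse of \<open>f\<close> to the
  index set of \<open>X\<close>.
\<close>

lemma (in prob_space) indep_vars_compose_inj:
  assumes indep: "indep_vars (\<lambda>_. N) X (f ` I)" and inj: "inj_on f I"
  shows "indep_vars (\<lambda>_. N) (\<lambda>i. X (f i)) I"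
proof -
  define F where "F j = {X j -` A \<inter> space M | A. A \<in> sets N}" for j
  have rv: "\<forall>j\<in>f ` I. random_variable N (X j)" and F: "indep_sets F (f ` I)"
    using indep unfolding indep_vars_def2 F_def by auto
  have "indep_sets (\<lambda>i. F (f i)) I"
  proof (rule indep_setsI)
    show "F (f i) \<subseteq> events" if "i \<in> I" for i
      using F that by (auto simp: indep_sets_def)
  next
    fix A J assume J: "J \<noteq> {}" "J \<subseteq> I" "finite J" and A: "\<forall>j\<in>J. A j \<in> F (f j)"
    have inj_J: "inj_on f J"
      using inj J(2) by (rule inj_on_subset)
    let ?A = "\<lambda>k. A (the_inv_into J f k)"
    have A_f: "?A (f j) = A j" if "j \<in> J" for j
      using the_inv_into_f_f [OF inj_J that] by simp
    have "prob (\<Inter>k\<in>f ` J. ?A k) = (\<Prod>k\<in>f ` J. prob (?A k))"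
      using F J A by (intro indep_setsD [OF F]) (auto simp: A_f)
    then show "prob (\<Inter>j\<in>J. A j) = (\<Prod>j\<in>J. prob (A j))"
      by (simp add: A_f prod.reindex [OF inj_J])
  qed
  with rv show ?thesis
    unfolding indep_vars_def2 F_def by auto
qed

lemma argmax_design_eqI:
  fixes f :: "nat \<Rightarrow> real"
  assumes "tie_rule K tie" and "k \<in> {1..K}" and "\<And>i. i \<in> {1..K} \<Longrightarrow> i \<noteq> k \<Longrightarrow> f i < f k"
  shows "argmax_design tie K f = k"
proof -
  have "{i. is_arg_max f (\<lambda>j. j \<in> {1..K}) i} = {k}"
  proof (intro equalityI subsetI)
    fix i assume i: "i \<in> {i. is_arg_max f (\<lambda>j. j \<in> {1..K}) i}"
    then have "i \<in> {1..K}" "\<not> f i < f k"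
      using assms(2) by (auto simp: is_arg_max_def)
    with assms(3) show "i \<in> {k}"
      by blast
  next
    fix i assume "i \<in> {k}"
    moreover have "\<not> f k < f j" if "j \<in> {1..K}" for j
      using assms(3) [OF that] by (cases "j = k") (simp_all add: less_not_sym)
    ultimately show "i \<in> {i. is_arg_max f (\<lambda>j. j \<in> {1..K}) i}"
      using assms(2) by (simp add: is_arg_max_def)
  qed
  moreover have "tie {k} \<in> {k}"
    using assms(1,2) unfolding tie_rule_def by blast
  ultimately show ?thesis
    by (simp add: argmax_design_def)
qed

text \<open>
  The final sizes \<open>N \<omega> i\<close> may depend on \<open>\<omega>\<close> in any way, because the error event is enlarged to the
  measurable event that for some design \<open>i\<close> and \<^emph>\<open>some\<close> \<open>n \<ge> m\<close> the mean of its first \<open>n\<close> samples lies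
  on the wrong side of the threshold \<open>c\<close>. That event is the same for all allocation rules, and
  off it the design with the largest sample mean is design 1.
\<close>

lemma (in prob_space) pfs_le_sum_exp:
  fixes X :: "nat \<Rightarrow> nat \<Rightarrow> 'a \<Rightarrow> real" and \<mu> \<sigma> :: "nat \<Rightarrow> real" and c :: real
  defines "a \<equiv> \<lambda>i. (c - \<mu> i)\<^sup>2 / (2 * (\<sigma> i)\<^sup>2)"
  assumes "K \<ge> 1" and "tie_rule K tie"
    and "\<And>i. i \<in> {1..K} \<Longrightarrow> \<sigma> i > 0"
    and normal: "\<And>i r. i \<in> {1..K} \<Longrightarrow> r \<ge> 1 \<Longrightarrow>
      distributed M lborel (X i r) (normal_density (\<mu> i) (\<sigma> i))"
    and indep: "\<And>i. i \<in> {1..K} \<Longrightarrow> indep_vars (\<lambda>_. borel) (X i) {1..}"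
    and c1: "c < \<mu> 1" and c2: "\<And>i. i \<in> {2..K} \<Longrightarrow> \<mu> i < c"
    and out: "\<And>\<omega>. out \<omega> = best_hat tie K (\<lambda>i r. X i r \<omega>) (N \<omega>)"
    and N: "\<And>\<omega> i. i \<in> {1..K} \<Longrightarrow> m \<le> N \<omega> i" and "m \<ge> 1"
  shows "pfs M tie K \<mu> out \<le> (\<Sum>i=1..K. exp (- (a i * real m)) / (1 - exp (- a i)))"
proof -
  define wrong_side where "wrong_side i y \<longleftrightarrow> (if i = 1 then y \<le> c else c \<le> y)" for i :: nat and y
  let ?mean = "\<lambda>i n \<omega>. sample_mean (\<lambda>r. X i r \<omega>) n"
  let ?E = "\<lambda>i. {\<omega> \<in> space M. \<exists>n\<ge>m. wrong_side i (?mean i n \<omega>)}"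
  have E: "?E i \<in> events \<and> prob (?E i) \<le> exp (- (a i * real m)) / (1 - exp (- a i))"
    if i: "i \<in> {1..K}" for i
  proof -
    have c: "c < \<mu> i" if "i = 1"
      using c1 that by simp
    have c': "\<mu> i < c" if "i \<noteq> 1"
      using c2 i that by simp
    have "a i > 0"
      using c c' assms(4) [OF i] by (cases "i = 1") (auto simp: a_def)
    have tail: "{\<omega> \<in> space M. wrong_side i (?mean i n \<omega>)} \<in> events \<and>
        prob {\<omega> \<in> space M. wrong_side i (?mean i n \<omega>)} \<le> exp (- (a i * real n))" if "n \<ge> m" for n
    proof -
      have "n \<ge> 1"
        using that \<open>m \<ge> 1\<close> by simp
      have "?mean i n \<in> borel_measurable M"
        using distributed_measurable [OF normal_sample_mean_distributed [OF indep [OF i] normal [OF i]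
            assms(4) [OF i] \<open>n \<ge> 1\<close>]] by simp
      then have "{\<omega> \<in> space M. wrong_side i (?mean i n \<omega>)} \<in> events"
        unfolding wrong_side_def by (cases "i = 1") simp_all
      moreover have "prob {\<omega> \<in> space M. wrong_side i (?mean i n \<omega>)} \<le> exp (- (a i * real n))"
      proof (cases "i = 1")
        case True
        then show ?thesis
          using normal_sample_mean_lower_tail
            [OF indep [OF i] normal [OF i] assms(4) [OF i] \<open>n \<ge> 1\<close> less_imp_le [OF c]]
          by (simp add: wrong_side_def a_def)
      next
        case False
        then show ?thesis
          using normal_sample_mean_upper_tail
            [OF indep [OF i] normal [OF i] assms(4) [OF i] \<open>n \<ge> 1\<close> less_imp_le [OF c']]
          by (simp add: wrong_side_def a_def)
      qed
      ultimately show ?thesis ..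
    qed
    show ?thesis
      using prob_exists_ge_le_exp [OF tail [THEN conjunct1] tail [THEN conjunct2] \<open>a i > 0\<close>]
      by (rule conjI)
  qed
  then have E_events: "?E i \<in> events" if "i \<in> {1..K}" for i
    using that by blast
  have best: "argmax_design tie K \<mu> = 1"
  proof (rule argmax_design_eqI)
    fix i assume "i \<in> {1..K}" "i \<noteq> 1"
    then show "\<mu> i < \<mu> 1"
      using c1 c2 [of i] by simp
  qed (use assms(2,3) in auto)
  have "{\<omega> \<in> space M. out \<omega> \<noteq> argmax_design tie K \<mu>} \<subseteq> (\<Union>i\<in>{1..K}. ?E i)"
  proof (intro subsetI, rule ccontr)
    fix \<omega>
    assume \<omega>: "\<omega> \<in> {\<omega> \<in> space M. out \<omega> \<noteq> argmax_design tie K \<mu>}" "\<omega> \<notin> (\<Union>i\<in>{1..K}. ?E i)"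
    then have right_side: "\<not> wrong_side i (?mean i (N \<omega> i) \<omega>)" if "i \<in> {1..K}" for i
      using N that by blast
    have "best_hat tie K (\<lambda>i r. X i r \<omega>) (N \<omega>) = 1"
      unfolding best_hat_def
    proof (rule argmax_design_eqI)
      fix i assume "i \<in> {1..K}" "i \<noteq> 1"
      then show "?mean i (N \<omega> i) \<omega> < ?mean 1 (N \<omega> 1) \<omega>"
        using right_side [of i] right_side [of 1] \<open>K \<ge> 1\<close> by (simp add: wrong_side_def)
    qed (use assms(2,3) in auto)
    with \<omega> out best show False
      by simp
  qed
  then have "pfs M tie K \<mu> out \<le> prob (\<Union>i\<in>{1..K}. ?E i)"
    unfolding pfs_def
    by (rule finite_measure_mono) (rule sets.finite_UN [OF finite_atLeastAtMost E_events])
  also have "\<dots> \<le> (\<Sum>i=1..K. prob (?E i))"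
    by (rule finite_measure_subadditive_finite [OF finite_atLeastAtMost image_subsetI [OF E_events]])
  also have "\<dots> \<le> (\<Sum>i=1..K. exp (- (a i * real m)) / (1 - exp (- a i)))"
    by (intro sum_mono E [THEN conjunct2])
  finally show ?thesis .
qed

section \<open>The three algorithms\<close>

lemma ocba_alloc_ge_initial: "N0 \<le> ocba_alloc tie K \<Delta> N0 x l i"
  by (induction l) (simp_all add: Let_def le_max_iff_disj)

lemma seq_alloc_ge_initial: "N0 \<le> seq_alloc sel N0 l i"
  by (induction l) (auto simp: Let_def)

theorem theorem3p2:
  fixes M :: "'a measure"
    and K :: nat
    and \<mu> \<sigma> :: "nat \<Rightarrow> real"
    and X :: "nat \<Rightarrow> nat \<Rightarrow> 'a \<Rightarrow> real"
    and tie :: "nat set \<Rightarrow> nat"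
    and \<alpha>\<^sub>0 \<delta> :: real
    and \<delta>bar :: "nat \<Rightarrow> real"
    and N\<^sub>0 :: "real \<Rightarrow> nat"
    and bound :: "(nat \<Rightarrow> real) \<Rightarrow> real \<Rightarrow> real"
  assumes "prob_space M"
    and "K \<ge> 2"
    and "\<forall>i j. 1 \<le> i \<and> i < j \<and> j \<le> K \<longrightarrow> \<mu> i > \<mu> j"
    and "\<forall>i\<in>{1..K}. \<sigma> i > 0"
    and "\<forall>i\<in>{1..K}. \<forall>r\<ge>1. distributed M lborel (X i r) (normal_density (\<mu> i) (\<sigma> i))"
    and "prob_space.indep_vars M (\<lambda>_. borel) (\<lambda>(i, r). X i r) ({1..K} \<times> {1..})"
    and "tie_rule K tie"
    and "0 < \<alpha>\<^sub>0" and "\<alpha>\<^sub>0 < 1"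
    and "\<forall>T. N\<^sub>0 T = nat \<lfloor>\<alpha>\<^sub>0 * T\<rfloor>"
    and "\<delta> = \<mu> 1 - \<mu> 2"
    and "\<forall>i\<in>{2..K}. \<delta>bar i = \<mu> 2 - \<mu> i + \<delta> / 2"
    and "\<forall>C T. bound C T =
           C 1 * exp (- (\<delta>\<^sup>2 * \<alpha>\<^sub>0 * T) / (8 * (\<sigma> 1)\<^sup>2 * real K)) +
           (\<Sum>i=2..K. C i * exp (- ((\<delta>bar i)\<^sup>2 * \<alpha>\<^sub>0 * T) / (2 * (\<sigma> i)\<^sup>2 * real K)))"
  shows
    "(\<forall>\<Delta>\<ge>1. \<exists>C. (\<forall>i\<in>{1..K}. C i > 0) \<and>
        (\<forall>T. N\<^sub>0 T \<ge> 2 \<and> T \<ge> real (K * N\<^sub>0 T) \<longrightarrow>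
           pfs M tie K \<mu> (\<lambda>\<omega>. ocba_output tie K \<Delta> (N\<^sub>0 T) T (\<lambda>i r. X i r \<omega>)) \<le> bound C T)) \<and>
     (\<exists>C. (\<forall>i\<in>{1..K}. C i > 0) \<and>
        (\<forall>T. N\<^sub>0 T \<ge> 2 \<and> T \<ge> real (K * N\<^sub>0 T) \<longrightarrow>
           pfs M tie K \<mu> (\<lambda>\<omega>. ocba_d_output tie K (N\<^sub>0 T) T (\<lambda>i r. X i r \<omega>)) \<le> bound C T)) \<and>
     (\<forall>U :: nat \<Rightarrow> 'a \<Rightarrow> real.
        (\<forall>l. distr M lborel (U l) = uniform_measure lborel {0<..<1}) \<and>
        prob_space.indep_vars M (\<lambda>_. borel) (case_sum (\<lambda>(i, r). X i r) U)
          (({1..K} \<times> {1..}) <+> UNIV) \<longrightarrow>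
        (\<exists>C. (\<forall>i\<in>{1..K}. C i > 0) \<and>
          (\<forall>T. N\<^sub>0 T \<ge> 2 \<and> T \<ge> real (K * N\<^sub>0 T) \<longrightarrow>
             pfs M tie K \<mu> (\<lambda>\<omega>. ocba_r_output tie K (N\<^sub>0 T) T (\<lambda>i r. X i r \<omega>) (\<lambda>l. U l \<omega>))
               \<le> bound C T)))"
proof -
  interpret prob_space M by fact
  \<comment> \<open>The midpoint between the two largest means.\<close>
  define c where "c = \<mu> 1 - \<delta> / 2"
  define a where "a i = (c - \<mu> i)\<^sup>2 / (2 * (\<sigma> i)\<^sup>2)" for i
  define C where "C i = exp (a i) / (1 - exp (- a i))" for i
  have K: "1 \<in> {1..K}"
    using assms(2) by simp
  have \<sigma>: "\<sigma> i > 0" if "i \<in> {1..K}" for i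
    using assms(4) that by blast
  have "\<delta> > 0"
    using assms(2,3,11) by simp
  then have c1: "c < \<mu> 1"
    by (simp add: c_def)
  have c2: "\<mu> i < c" if "i \<in> {2..K}" for i
  proof -
    have "\<mu> i \<le> \<mu> 2"
      using assms(3) that by (cases "i = 2") (auto intro: less_imp_le)
    with \<open>\<delta> > 0\<close> show ?thesis
      unfolding c_def assms(11) by (simp add: field_simps)
  qed
  have a_pos: "a i > 0" if "i \<in> {1..K}" for i
    using c1 c2 [of i] \<sigma> [OF that] that by (cases "i = 1") (auto simp: a_def)
  then have C_pos: "C i > 0" if "i \<in> {1..K}" for i
    using that by (simp add: C_def)
  have indep: "indep_vars (\<lambda>_. borel) (X i) {1..}" if "i \<in> {1..K}" for i
  proof -
    have "indep_vars (\<lambda>_. borel) (\<lambda>(i, r). X i r) (Pair i ` {1..})"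
      using assms(6) by (rule indep_vars_subset) (use that in auto)
    then show ?thesis
      using indep_vars_compose_inj [of borel "\<lambda>(i, r). X i r" "Pair i" "{1..}"]
      by (simp add: inj_on_def)
  qed
  have bound: "bound C T = (\<Sum>i=1..K. C i * exp (- (a i * \<alpha>\<^sub>0 * T / real K)))" for T
  proof -
    have "(\<Sum>i=1..K. C i * exp (- (a i * \<alpha>\<^sub>0 * T / real K))) =
        C 1 * exp (- (a 1 * \<alpha>\<^sub>0 * T / real K)) + (\<Sum>i=2..K. C i * exp (- (a i * \<alpha>\<^sub>0 * T / real K)))"
      using K by (simp add: sum.atLeast_Suc_atMost numeral_2_eq_2)
    also have "a 1 * \<alpha>\<^sub>0 * T / real K = \<delta>\<^sup>2 * \<alpha>\<^sub>0 * T / (8 * (\<sigma> 1)\<^sup>2 * real K)"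
      by (simp add: a_def c_def power_divide)
    also have "(\<Sum>i=2..K. C i * exp (- (a i * \<alpha>\<^sub>0 * T / real K))) =
        (\<Sum>i=2..K. C i * exp (- ((\<delta>bar i)\<^sup>2 * \<alpha>\<^sub>0 * T / (2 * (\<sigma> i)\<^sup>2 * real K))))"
    proof (intro sum.cong refl)
      fix i assume i: "i \<in> {2..K}"
      then have "c - \<mu> i = \<delta>bar i"
        using assms(12) by (simp add: c_def assms(11) field_simps)
      then show "C i * exp (- (a i * \<alpha>\<^sub>0 * T / real K)) =
          C i * exp (- ((\<delta>bar i)\<^sup>2 * \<alpha>\<^sub>0 * T / (2 * (\<sigma> i)\<^sup>2 * real K)))"
        by (simp add: a_def)
    qed
    finally show ?thesis
      using assms(13) by simp
  qed
  have pfs_le: "pfs M tie K \<mu> out \<le> bound C T"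
    if T: "N\<^sub>0 T \<ge> 2 \<and> T \<ge> real (K * N\<^sub>0 T)"
      and out: "\<And>\<omega>. out \<omega> = best_hat tie K (\<lambda>i r. X i r \<omega>) (N \<omega>)"
      and N: "\<And>\<omega> i. N\<^sub>0 T \<le> N \<omega> i" for T out N
  proof -
    have "T \<ge> 0"
      using T by (meson of_nat_0_le_iff order_trans)
    have "pfs M tie K \<mu> out \<le> (\<Sum>i=1..K. exp (- (a i * real (N\<^sub>0 T))) / (1 - exp (- a i)))"
      unfolding a_def
    proof (rule pfs_le_sum_exp [where X = X and N = N])
      show "distributed M lborel (X i r) (normal_density (\<mu> i) (\<sigma> i))"
        if "i \<in> {1..K}" "r \<ge> 1" for i r
        using assms(5) that by blast
    qed (use K T assms(7) \<sigma> indep c1 c2 out N in auto)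
    also have "\<dots> \<le> (\<Sum>i=1..K. C i * exp (- (a i * \<alpha>\<^sub>0 * T / real K)))"
    proof (intro sum_mono)
      fix i assume i: "i \<in> {1..K}"
      \<comment> \<open>The \<open>+ 1\<close> lost in rounding \<open>\<alpha>\<^sub>0 T\<close> down is absorbed by the factor \<open>exp (a i)\<close> of \<open>C i\<close>.\<close>
      have "\<alpha>\<^sub>0 * T / real K \<le> \<alpha>\<^sub>0 * T"
        using divide_left_mono [of 1 "real K" "\<alpha>\<^sub>0 * T"] K assms(8) \<open>T \<ge> 0\<close> by simp
      also have "\<dots> \<le> real (N\<^sub>0 T) + 1"
        unfolding assms(10) [rule_format] by linarith
      finally have "a i * (\<alpha>\<^sub>0 * T / real K) \<le> a i * (real (N\<^sub>0 T) + 1)"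
        using a_pos [OF i] by (intro mult_left_mono) auto
      then have "exp (- (a i * real (N\<^sub>0 T))) \<le> exp (a i) * exp (- (a i * \<alpha>\<^sub>0 * T / real K))"
        by (simp add: exp_add [symmetric] algebra_simps)
      then show "exp (- (a i * real (N\<^sub>0 T))) / (1 - exp (- a i)) \<le> C i * exp (- (a i * \<alpha>\<^sub>0 * T / real K))"
        using a_pos [OF i] by (simp add: C_def divide_right_mono)
    qed
    finally show ?thesis
      by (simp add: bound)
  qed
  show ?thesis
  proof (intro conjI allI impI exI [of _ C] ballI C_pos)
    fix \<Delta> T :: real
    assume "N\<^sub>0 T \<ge> 2 \<and> T \<ge> real (K * N\<^sub>0 T)"
    then show "pfs M tie K \<mu> (\<lambda>\<omega>. ocba_output tie K \<Delta> (N\<^sub>0 T) T (\<lambda>i r. X i r \<omega>)) \<le> bound C T"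
      by (rule pfs_le) (simp only: ocba_output_def Let_def, rule ocba_alloc_ge_initial)
  next
    fix T
    assume "N\<^sub>0 T \<ge> 2 \<and> T \<ge> real (K * N\<^sub>0 T)"
    then show "pfs M tie K \<mu> (\<lambda>\<omega>. ocba_d_output tie K (N\<^sub>0 T) T (\<lambda>i r. X i r \<omega>)) \<le> bound C T"
      by (rule pfs_le)
        (simp only: ocba_d_output_def seq_output_def Let_def, rule seq_alloc_ge_initial)
  next
    fix U :: "nat \<Rightarrow> 'a \<Rightarrow> real" and T
    assume "N\<^sub>0 T \<ge> 2 \<and> T \<ge> real (K * N\<^sub>0 T)"
    then show "pfs M tie K \<mu> (\<lambda>\<omega>. ocba_r_output tie K (N\<^sub>0 T) T (\<lambda>i r. X i r \<omega>) (\<lambda>l. U l \<omega>))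
        \<le> bound C T"
      by (rule pfs_le)
        (simp only: ocba_r_output_def seq_output_def Let_def, rule seq_alloc_ge_initial)
  qed
qed

end
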